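(* Let $X$ be a finite set equipped with a probability measure $\mu$, and let $\mathcal F \subseteq L^2(\mu)$ be a collection of real-valued functions on $X$ with $\sup_{\varphi \in \mathcal F} \|\varphi\|_\infty \le 1$. Then for every $0 < \eta < e^{-3}$ and every $f \in \Delta_X$, there exists $g \in \Delta_X$ such that: (1) $\|f-g\|_{\mathcal F} \le \eta$; (2) there is a subset $\mathcal F' \subseteq \mathcal F$ with $|\mathcal F'| \le 9\,\mathrm{Ent}_\mu(f)/\eta^2$, such that $g$ is a non-negative linear combination of degree-$d$ Riesz $\mathcal F'$-products for some \[ d \le 12\,\frac{\mathrm{Ent}_\mu(f)}{\eta} + O\!\left(\frac{\log(1/\eta)}{\log\log(1/\eta)}\right), \] where the implied constant in $O(\cdot)$ is absolute.
   Context: $L^2(\mu)$ is the space of real-valued functions on $X$ with inner product $\langle f,g\rangle = \sum_{x\in X}\mu(x)f(x)g(x)$; $\mathbb E_\mu h = \sum_x \mu(x)h(x)$ and $\|h\|_p = (\mathbb E_\mu|h|^p)^{1/p}$. The set of densities is $\Delta_X = \{f : X \to [0,\infty) : \|f\|_1 = 1\}$. The relative entropy of $f\in\Delta_X$ is $\mathrm{Ent}_\mu(f) = \mathbb E_\mu[f\log f]$ (with $0\log 0=0$). The semi-norm is $\|h\|_{\mathcal F} = \sup_{\varphi\in\mathcal F}|\langle \varphi, h\rangle|$. For a subcollection $\mathcal F'\subseteq\mathcal F$, a degree-$d$ Riesz $\mathcal F'$-product is a function $R(x) = \prod_{i=1}^d (1+\epsilon_i\varphi_i(x))$ with $d\ge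 1$, $\varphi_1,\dots,\varphi_d\in\mathcal F'$ and $\epsilon_1,\dots,\epsilon_d\in\{-1,0,1\}$.
   Formalization: Riesz products require φ_i ∈ F' only when ε_i ≠ 0, so the constant 1 is a product even for empty F' (otherwise the claim fails, e.g. for f = 1, where Ent = 0 forces F' empty); X is taken to be a finite set of natural numbers. *)

theory Defs
  imports Complex_Main
begin

text \<open>The finite ground set X is modelled as a finite set of naturals (every finite set
is in bijection with one); functions on X are functions nat => real whose values
outside X are irrelevant.\<close>

definition prob_on :: "nat set \<Rightarrow> (nat \<Rightarrow> real) \<Rightarrow> bool" where
  "prob_on X \<mu> \<longleftrightarrow> finite X \<and> (\<forall>x\<in>X. \<mu> x \<ge> 0) \<and> (\<Sum>x\<in>X. \<mu> x) = 1"

definition inner_mu :: "nat set \<Rightarrow> (nat \<Rightarrow> real) \<Rightarrow> (nat \<Rightarrow> real) \<Rightarrow> (nat \<Rightarrow> real) \<Rightarrow> real" where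
  "inner_mu X \<mu> f g = (\<Sum>x\<in>X. \<mu> x * f x * g x)"

definition expect :: "nat set \<Rightarrow> (nat \<Rightarrow> real) \<Rightarrow> (nat \<Rightarrow> real) \<Rightarrow> real" where
  "expect X \<mu> h = (\<Sum>x\<in>X. \<mu> x * h x)"

definition density :: "nat set \<Rightarrow> (nat \<Rightarrow> real) \<Rightarrow> (nat \<Rightarrow> real) \<Rightarrow> bool" where
  "density X \<mu> f \<longleftrightarrow> (\<forall>x\<in>X. f x \<ge> 0) \<and> expect X \<mu> (\<lambda>x. \<bar>f x\<bar>) = 1"

definition Ent :: "nat set \<Rightarrow> (nat \<Rightarrow> real) \<Rightarrow> (nat \<Rightarrow> real) \<Rightarrow> real" where
  "Ent X \<mu> f = expect X \<mu> (\<lambda>x. if f x = 0 then 0 else f x * ln (f x))"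

definition Fnorm_le :: "nat set \<Rightarrow> (nat \<Rightarrow> real) \<Rightarrow> (nat \<Rightarrow> real) set \<Rightarrow> (nat \<Rightarrow> real) \<Rightarrow> real \<Rightarrow> bool" where
  "Fnorm_le X \<mu> F h \<eta> \<longleftrightarrow> (\<forall>\<phi>\<in>F. \<bar>inner_mu X \<mu> \<phi> h\<bar> \<le> \<eta>)"

text \<open>Degree-d Riesz F'-product (as a function on X). Factors with epsilon_i = 0 are
identically 1, so phi_i is only required to lie in F' when epsilon_i is nonzero.\<close>
definition riesz_product :: "nat set \<Rightarrow> (nat \<Rightarrow> real) set \<Rightarrow> nat \<Rightarrow> (nat \<Rightarrow> real) \<Rightarrow> bool" where
  "riesz_product X F' d R \<longleftrightarrow> d \<ge> 1 \<and>
     (\<exists>(\<phi> :: nat \<Rightarrow> nat \<Rightarrow> real) (\<epsilon> :: nat \<Rightarrow> real).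
        (\<forall>i<d. \<epsilon> i \<in> {-1, 0, 1} \<and> (\<epsilon> i \<noteq> 0 \<longrightarrow> \<phi> i \<in> F')) \<and>
        (\<forall>x\<in>X. R x = (\<Prod>i<d. 1 + \<epsilon> i * \<phi> i x)))"

definition nonneg_comb_riesz :: "nat set \<Rightarrow> (nat \<Rightarrow> real) set \<Rightarrow> nat \<Rightarrow> (nat \<Rightarrow> real) \<Rightarrow> bool" where
  "nonneg_comb_riesz X F' d g \<longleftrightarrow>
     (\<exists>(n::nat) (c :: nat \<Rightarrow> real) (R :: nat \<Rightarrow> nat \<Rightarrow> real).
        (\<forall>j<n. c j \<ge> 0 \<and> riesz_product X F' d (R j)) \<and>
        (\<forall>x\<in>X. g x = (\<Sum>j<n. c j * R j x)))"

end

theory Submission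
  imports Defs
begin

text \<open>
Mirror descent with step \<open>s = \<eta>/3\<close>: as long as some \<open>\<plusminus>\<phi> \<in> F\<close> separates \<open>f\<close> from the Gibbs density
\<open>g = exp (y - m)\<close>, where \<open>m = ln E (exp y)\<close>, by more than \<open>2s\<close>, adding \<open>s (1 \<plusminus> \<phi>)\<close> to \<open>y\<close> lowers the
relative entropy of \<open>f\<close> with respect to \<open>g\<close> by at least \<open>s\<^sup>2\<close>. Hence there are at most \<open>Ent f / s\<^sup>2\<close>
steps, and the final exponent satisfies \<open>0 \<le> y \<le> M = 6 Ent f / \<eta>\<close>.

A power of \<open>y\<close> is a non-negative combination of Riesz products, so it remains to replace \<open>exp y\<close> by
a polynomial of degree about \<open>2M\<close>. The plain Taylor polynomial has relative error about
\<open>exp (-cM)\<close>, which is too large when \<open>M\<close> is small compared with \<open>ln (1/\<eta>)\<close>. Increasing its top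
coefficient makes the ratio \<open>q(y)\<close> of polynomial to exponential stationary at \<open>y = m\<close>, so that
\<open>0 \<le> q(m) - q(y) \<le> K (y - m)\<^sup>2\<close>. The error after normalisation is then controlled by
\<open>K E (g ln\<^sup>2 g) \<le> K (2 + M) Ent g\<close>, and \<open>Ent g \<le> 3 Ent f = \<eta> M / 2\<close> supplies the missing factor
\<open>\<eta>\<close>. The degree is therefore \<open>12 Ent f / \<eta> + O(1)\<close>.
\<close>

section \<open>Elementary estimates for the exponential\<close>

text \<open>The quadratic term becomes the second-order loss of a descent step. For negative
  \<open>x = - w\<close> the bound rests on \<open>(1 - w + w\<^sup>2) * (1 + w) = 1 + w ^ 3\<close>
  together with \<open>1 + w \<le> exp w\<close>.\<close>

lemma exp_le_quadratic:
  fixes x :: real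
  assumes "\<bar>x\<bar> \<le> 1"
  shows "exp x \<le> 1 + x + x\<^sup>2"
proof (cases "0 \<le> x")
  case True
  then show ?thesis using exp_bound[of x] assms by simp
next
  case False
  define w where "w = - x"
  have w: "0 \<le> w" using False by (simp add: w_def)
  have "1 \<le> (1 - w + w\<^sup>2) * (1 + w)"
  proof -
    have "(1 - w + w\<^sup>2) * (1 + w) = 1 + w ^ 3" by algebra
    then show ?thesis using w by simp
  qed
  also have "\<dots> \<le> (1 - w + w\<^sup>2) * exp w"
  proof (rule mult_left_mono)
    have "1 - w + w\<^sup>2 = (1 - w)\<^sup>2 + w" by algebra
    also have "\<dots> \<ge> 0" using w by simp
    finally show "0 \<le> 1 - w + w\<^sup>2" .
  qed simp
  finally have "exp (- w) \<le> 1 - w + w\<^sup>2"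
    by (simp add: exp_minus field_simps)
  then show ?thesis by (simp add: w_def)
qed

lemma ln_le_of_le_exp:
  fixes x y :: real
  assumes "0 < x" "x \<le> exp y"
  shows "ln x \<le> y"
  using assms ln_le_cancel_iff[of x "exp y"] by simp

lemma power_div_fact_le_exp:
  fixes y :: real
  assumes "0 \<le> y"
  shows "y ^ k / fact k \<le> exp y"
proof -
  have "(\<Sum>i\<in>{k}. y ^ i /\<^sub>R fact i) \<le> (\<Sum>i. y ^ i /\<^sub>R fact i)"
    by (rule sum_le_suminf) (use assms summable_exp_generic[of y] in auto)
  then show ?thesis by (simp add: exp_def field_simps)
qed

text \<open>This turns a second moment of \<open>ln g\<close> into entropy: with
  \<open>exp u = g\<close>, the terms \<open>- exp u + 1\<close> average to zero over a density, and
  what remains on the right is \<open>(2 + M)\<close> times the entropy of \<open>g\<close>. Both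
  comparison functions vanish at 0; their derivatives are \<open>?h u\<close>, which is
  non-negative, and \<open>- (u\<^sup>2 * exp u)\<close>.\<close>

lemma square_exp_le_entropy_integrand:
  fixes u M :: real
  assumes "u \<le> M" "0 \<le> M"
  shows "u\<^sup>2 * exp u \<le> (2 + M) * (u * exp u - exp u + 1)"
proof -
  let ?h = "\<lambda>u::real. u * exp u - exp u + 1"
  have h_nonneg: "0 \<le> ?h v" for v :: real
  proof -
    have "1 - v \<le> exp (- v)" using exp_ge_add_one_self[of "- v"] by simp
    then have "(1 - v) * exp v \<le> exp (- v) * exp v" by (rule mult_right_mono) simp
    then show ?thesis by (simp add: exp_minus algebra_simps)
  qed
  show ?thesis
  proof (cases "0 \<le> u")
    case True
    let ?G = "\<lambda>u::real. (2 + u) * ?h u - u\<^sup>2 * exp u"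
    have "?G 0 \<le> ?G u"
    proof (rule DERIV_nonneg_imp_nondecreasing[OF True])
      fix x :: real
      have "(?G has_real_derivative ?h x) (at x)"
        by (auto intro!: derivative_eq_intros simp: algebra_simps power2_eq_square)
      then show "\<exists>y. (?G has_real_derivative y) (at x) \<and> 0 \<le> y"
        using h_nonneg by blast
    qed
    then have "u\<^sup>2 * exp u \<le> (2 + u) * ?h u" by simp
    also have "\<dots> \<le> (2 + M) * ?h u"
      by (rule mult_right_mono) (use assms h_nonneg in auto)
    finally show ?thesis .
  next
    case False
    let ?G = "\<lambda>u::real. 2 * ?h u - u\<^sup>2 * exp u"
    have "?G 0 \<le> ?G u"
    proof (rule DERIV_nonpos_imp_nonincreasing[of u 0])
      fix x :: real
      have "(?G has_real_derivative - (x\<^sup>2 * exp x)) (at x)"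
        by (auto intro!: derivative_eq_intros simp: algebra_simps power2_eq_square)
      then show "\<exists>y. (?G has_real_derivative y) (at x) \<and> y \<le> 0"
        by (intro exI conjI) auto
    qed (use False in auto)
    then have "u\<^sup>2 * exp u \<le> 2 * ?h u" by simp
    also have "\<dots> \<le> (2 + M) * ?h u"
      by (rule mult_right_mono) (use assms h_nonneg in auto)
    finally show ?thesis .
  qed
qed

section \<open>The corrected Taylor polynomial and its ratio to the exponential\<close>

text \<open>The multiple \<open>m / (d - m)\<close> of the top term is what makes \<open>exp (- y) * taylor_corr d m y\<close>
stationary at \<open>y = m\<close>.\<close>

definition taylor_corr :: "nat \<Rightarrow> real \<Rightarrow> real \<Rightarrow> real" where
  "taylor_corr d m y = (\<Sum>k\<le>d. y ^ k / fact k) + m / (real d - m) * (y ^ d / fact d)"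

lemma taylor_corr_ge_one:
  assumes "0 \<le> y" "0 \<le> m" "m < real d"
  shows "1 \<le> taylor_corr d m y"
proof -
  have "1 = (\<Sum>k\<in>{0}. y ^ k / fact k)" by simp
  also have "\<dots> \<le> (\<Sum>k\<le>d. y ^ k / fact k)"
    by (rule sum_mono2) (use assms in auto)
  finally show ?thesis using assms by (simp add: taylor_corr_def add_increasing2)
qed

text \<open>The two halves of the product rule telescope, leaving only the top Taylor term.\<close>

lemma has_derivative_exp_taylor:
  fixes y :: real
  shows "((\<lambda>y. exp (- y) * (\<Sum>k\<le>n. y ^ k / fact k)) has_real_derivative
           - (exp (- y) * (y ^ n / fact n))) (at y)"
proof (induction n)
  case 0
  then show ?case by (auto intro!: derivative_eq_intros)
next
  case (Suc n)
  have "((\<lambda>y. y ^ Suc n / fact (Suc n)) has_real_derivative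
          real (Suc n) * y ^ n / fact (Suc n)) (at y)"
    using DERIV_cdivide[OF DERIV_pow[of "Suc n" y UNIV], of "fact (Suc n)"] by simp
  moreover have "real (Suc n) * y ^ n / fact (Suc n) = y ^ n / fact n"
    unfolding fact_Suc of_nat_mult by (rule mult_divide_mult_cancel_left) simp
  ultimately have *: "((\<lambda>y. y ^ Suc n / fact (Suc n)) has_real_derivative y ^ n / fact n) (at y)"
    by simp
  have e: "((\<lambda>y. exp (- y)) has_real_derivative - exp (- y)) (at y)"
    by (auto intro!: derivative_eq_intros)
  have "((\<lambda>y. exp (- y) * (\<Sum>k\<le>n. y ^ k / fact k) + exp (- y) * (y ^ Suc n / fact (Suc n)))
     has_real_derivative - (exp (- y) * (y ^ n / fact n)) +
       (- exp (- y) * (y ^ Suc n / fact (Suc n)) + y ^ n / fact n * exp (- y))) (at y)"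
    by (rule DERIV_add[OF Suc.IH DERIV_mult[OF e *]])
  then show ?case by (simp add: distrib_left del: power_Suc fact_Suc)
qed

text \<open>With \<open>b\<close> the extra multiple of the top term, the derivative carries the
  linear factor \<open>b * real (Suc e) - (1 + b) * y\<close>. The choice of \<open>b\<close> puts
  its root at \<open>m\<close>.\<close>

lemma has_derivative_exp_taylor_corr:
  fixes y :: real
  assumes "m < real (Suc e)"
  shows "((\<lambda>y. exp (- y) * taylor_corr (Suc e) m y) has_real_derivative
           real (Suc e) / (real (Suc e) - m) * (m - y) * (exp (- y) * (y ^ e / fact (Suc e)))) (at y)"
proof -
  define b where "b = m / (real (Suc e) - m)"
  have b: "real (Suc e) / (real (Suc e) - m) = 1 + b" "(1 + b) * m = b * real (Suc e)"
    using assms by (simp_all add: b_def field_simps)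
  have e: "((\<lambda>y. exp (- y)) has_real_derivative - exp (- y)) (at y)"
    by (auto intro!: derivative_eq_intros)
  have p: "((\<lambda>y. b * (y ^ Suc e / fact (Suc e))) has_real_derivative
          b * (real (Suc e) * y ^ e / fact (Suc e))) (at y)"
    using DERIV_cmult[OF DERIV_cdivide[OF DERIV_pow[of "Suc e" y UNIV], of "fact (Suc e)"]] by simp
  have "((\<lambda>y. exp (- y) * (\<Sum>k\<le>Suc e. y ^ k / fact k) + exp (- y) * (b * (y ^ Suc e / fact (Suc e))))
     has_real_derivative - (exp (- y) * (y ^ Suc e / fact (Suc e))) +
       (- exp (- y) * (b * (y ^ Suc e / fact (Suc e)))
         + b * (real (Suc e) * y ^ e / fact (Suc e)) * exp (- y))) (at y)"
    by (rule DERIV_add[OF has_derivative_exp_taylor DERIV_mult[OF e p]])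
  moreover have "- (exp (- y) * (y ^ Suc e / fact (Suc e))) +
       (- exp (- y) * (b * (y ^ Suc e / fact (Suc e)))
         + b * (real (Suc e) * y ^ e / fact (Suc e)) * exp (- y))
     = (b * real (Suc e) - (1 + b) * y) * (exp (- y) * (y ^ e / fact (Suc e)))"
    by (simp add: algebra_simps add_divide_distrib diff_divide_distrib del: fact_Suc of_nat_Suc)
  moreover have "b * real (Suc e) - (1 + b) * y = (1 + b) * (m - y)"
    using b(2) by (simp add: algebra_simps del: of_nat_Suc)
  moreover have "(\<lambda>y. exp (- y) * taylor_corr (Suc e) m y) =
     (\<lambda>y. exp (- y) * (\<Sum>k\<le>Suc e. y ^ k / fact k) + exp (- y) * (b * (y ^ Suc e / fact (Suc e))))"
    by (auto simp: taylor_corr_def b_def distrib_left)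
  ultimately show ?thesis unfolding b(1) by simp
qed

text \<open>The derivative of \<open>q\<close> has the sign of \<open>m - x\<close>, so
  \<open>q\<close> peaks at \<open>m\<close>. Adding \<open>K * (x - m)\<^sup>2\<close> reverses
  that sign, because \<open>a \<le> 2\<close> and \<open>w x \<le> K\<close>; the sum
  \<open>H\<close> therefore has its minimum at \<open>m\<close>, which is the quadratic
  bound.\<close>

lemma exp_taylor_corr_deficit:
  fixes m M y :: real
  assumes y: "0 \<le> y" "y \<le> M" and m: "0 \<le> m" "m \<le> M" and d: "2 * M \<le> real (Suc e)"
  defines "q \<equiv> \<lambda>y. exp (- y) * taylor_corr (Suc e) m y"
  defines "K \<equiv> exp M / (2 ^ e * real (Suc e))"
  shows "q y \<le> q m" "q m - q y \<le> K * (y - m)\<^sup>2" "1 \<le> q m"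
proof -
  define a where "a = real (Suc e) / (real (Suc e) - m)"
  define w where "w = (\<lambda>x::real. exp (- x) * (x ^ e / fact (Suc e)))"
  have md: "m < real (Suc e)" and a: "0 \<le> a" "a \<le> 2"
    using m d by (auto simp: a_def field_simps)
  have q': "(q has_real_derivative a * (m - x) * w x) (at x)" for x
    using has_derivative_exp_taylor_corr[OF md, of x] by (simp add: q_def a_def w_def)
  have w0: "0 \<le> w x" if "0 \<le> x" for x using that by (simp add: w_def)
  have wK: "w x \<le> K" if "0 \<le> x" "x \<le> M" for x
  proof -
    \<comment> \<open>Bounding the power at \<open>2 * x\<close> instead of \<open>x\<close> gains
      the factor \<open>2 ^ e\<close> in the denominator and costs only
      \<open>exp x \<le> exp M\<close>.\<close>
    have "(2 * x) ^ e / fact e \<le> exp (2 * x)"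
      by (rule power_div_fact_le_exp) (use that in simp)
    then have "exp (- x) * ((2 * x) ^ e / fact e) \<le> exp (- x) * exp (2 * x)"
      by (rule mult_left_mono) simp
    also have "\<dots> \<le> exp M" using that by (simp flip: exp_add)
    finally have "exp (- x) * ((2 * x) ^ e / fact e) / (2 ^ e * real (Suc e)) \<le> K"
      unfolding K_def by (rule divide_right_mono) simp
    moreover have "(2 * x) ^ e / fact e / (2 ^ e * real (Suc e)) = x ^ e / fact (Suc e)"
      unfolding fact_Suc power_mult_distrib of_nat_mult by (simp del: of_nat_Suc)
    ultimately show ?thesis unfolding w_def by (simp only: times_divide_eq_right[symmetric])
  qed
  define H where "H = (\<lambda>x. q x + K * (x - m)\<^sup>2)"
  have H': "(H has_real_derivative (m - x) * (a * w x - 2 * K)) (at x)" for x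
  proof -
    have "((\<lambda>x. K * (x - m)\<^sup>2) has_real_derivative K * (2 * (x - m))) (at x)"
      by (auto intro!: derivative_eq_intros)
    from DERIV_add[OF q' this] show ?thesis by (simp add: H_def algebra_simps)
  qed
  have aw: "a * w x - 2 * K \<le> 0" if "0 \<le> x" "x \<le> M" for x
    using mult_mono[of a 2 "w x" K] a w0[OF that(1)] wK[OF that] by simp
  have q_incr: "q u \<le> q v" if "0 \<le> u" "u \<le> v" "v \<le> m" for u v
  proof (rule DERIV_nonneg_imp_nondecreasing[OF that(2)])
    fix x assume "u \<le> x" "x \<le> v"
    then have "0 \<le> a * (m - x) * w x" using that a w0 by simp
    then show "\<exists>z. (q has_real_derivative z) (at x) \<and> 0 \<le> z" using q' by blast
  qed
  have "q m \<ge> q 0" by (rule q_incr) (use m in auto)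
  moreover have "taylor_corr (Suc e) m 0 \<ge> 1" by (rule taylor_corr_ge_one) (use m md in auto)
  ultimately show "1 \<le> q m" by (simp add: q_def)
  show "q y \<le> q m"
  proof (cases "y \<le> m")
    case True then show ?thesis using q_incr y by blast
  next
    case False
    then have "m \<le> y" by simp
    then show ?thesis
    proof (rule DERIV_nonpos_imp_nonincreasing)
      fix x assume "m \<le> x"
      then have "a * (m - x) * w x \<le> 0"
        using a w0[of x] m by (intro mult_nonpos_nonneg mult_nonneg_nonpos) auto
      then show "\<exists>z. (q has_real_derivative z) (at x) \<and> z \<le> 0" using q' by blast
    qed
  qed
  have "H m \<le> H y"
  proof (cases "y \<le> m")
    case True
    then show ?thesis
    proof (rule DERIV_nonpos_imp_nonincreasing)
      fix x assume "y \<le> x" "x \<le> m"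
      then have "(m - x) * (a * w x - 2 * K) \<le> 0"
        using aw[of x] m y by (intro mult_nonneg_nonpos) auto
      then show "\<exists>z. (H has_real_derivative z) (at x) \<and> z \<le> 0" using H' by blast
    qed
  next
    case False
    then have "m \<le> y" by simp
    then show ?thesis
    proof (rule DERIV_nonneg_imp_nondecreasing)
      fix x assume "m \<le> x" "x \<le> y"
      then have "0 \<le> (m - x) * (a * w x - 2 * K)"
        using aw[of x] m y by (intro mult_nonpos_nonpos) auto
      then show "\<exists>z. (H has_real_derivative z) (at x) \<and> 0 \<le> z" using H' by blast
    qed
  qed
  then show "q m - q y \<le> K * (y - m)\<^sup>2" by (simp add: H_def)
qed

section \<open>The cone generated by Riesz products of a given degree\<close>

lemma riesz_product_mult_factor:
  assumes "riesz_product X F' d R" and "\<epsilon> \<in> {-1, 0, 1}" and "\<epsilon> \<noteq> 0 \<Longrightarrow> \<phi> \<in> F'"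
  shows "riesz_product X F' (Suc d) (\<lambda>x. R x * (1 + \<epsilon> * \<phi> x))"
proof -
  obtain \<phi>' \<epsilon>' where "d \<ge> 1"
    and *: "\<And>i. i < d \<Longrightarrow> \<epsilon>' i \<in> {-1, 0, 1} \<and> (\<epsilon>' i \<noteq> 0 \<longrightarrow> \<phi>' i \<in> F')"
    and R: "\<And>x. x \<in> X \<Longrightarrow> R x = (\<Prod>i<d. 1 + \<epsilon>' i * \<phi>' i x)"
    using assms(1) unfolding riesz_product_def by metis
  have "(\<Prod>i<d. 1 + (\<epsilon>'(d := \<epsilon>)) i * (\<phi>'(d := \<phi>)) i x) = (\<Prod>i<d. 1 + \<epsilon>' i * \<phi>' i x)" for x
    by (rule prod.cong) auto
  moreover have "(\<epsilon>'(d := \<epsilon>)) i \<in> {-1, 0, 1} \<and>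
      ((\<epsilon>'(d := \<epsilon>)) i \<noteq> 0 \<longrightarrow> (\<phi>'(d := \<phi>)) i \<in> F')" if "i < Suc d" for i
    using that *[of i] assms(2,3) by (cases "i = d") auto
  moreover have "(\<Prod>i<Suc d. 1 + (\<epsilon>'(d := \<epsilon>)) i * (\<phi>'(d := \<phi>)) i x)
      = (\<Prod>i<d. 1 + (\<epsilon>'(d := \<epsilon>)) i * (\<phi>'(d := \<phi>)) i x) * (1 + \<epsilon> * \<phi> x)" for x
    by simp
  ultimately show ?thesis
    unfolding riesz_product_def using R
    by (intro conjI exI[of _ "\<phi>'(d := \<phi>)"] exI[of _ "\<epsilon>'(d := \<epsilon>)"])
       (simp_all del: fun_upd_apply prod.lessThan_Suc)
qed

lemma nonneg_comb_rieszI: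
  fixes n :: nat and c :: "nat \<Rightarrow> real"
  assumes "\<And>j. j < n \<Longrightarrow> c j \<ge> 0 \<and> riesz_product X F' d (R j)"
    and "\<And>x. x \<in> X \<Longrightarrow> g x = (\<Sum>j<n. c j * R j x)"
  shows "nonneg_comb_riesz X F' d g"
  unfolding nonneg_comb_riesz_def
  by (rule exI[of _ n], rule exI[of _ c], rule exI[of _ R]) (use assms in simp)

lemma nonneg_comb_rieszE:
  assumes "nonneg_comb_riesz X F' d g"
  obtains n c and R :: "nat \<Rightarrow> nat \<Rightarrow> real"
  where "\<forall>j<n. c j \<ge> 0 \<and> riesz_product X F' d (R j)"
    and "\<forall>x\<in>X. g x = (\<Sum>j<n. c j * R j x)"
proof -
  from assms obtain n c and R :: "nat \<Rightarrow> nat \<Rightarrow> real"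
    where "(\<forall>j<n. c j \<ge> 0 \<and> riesz_product X F' d (R j)) \<and> (\<forall>x\<in>X. g x = (\<Sum>j<n. c j * R j x))"
    unfolding nonneg_comb_riesz_def by (elim exE)
  then show thesis by (intro that[of n c R]) simp_all
qed

lemma nonneg_comb_riesz_cong:
  assumes "nonneg_comb_riesz X F' d g" "\<And>x. x \<in> X \<Longrightarrow> h x = g x"
  shows "nonneg_comb_riesz X F' d h"
  using assms by (simp add: nonneg_comb_riesz_def)

lemma nonneg_comb_riesz_zero: "nonneg_comb_riesz X F' d (\<lambda>x. 0)"
  unfolding nonneg_comb_riesz_def by (rule exI[of _ 0]) simp

text \<open>Riesz products have degree at least 1, so the constant is realised by one factor of sign
  zero. This causes the shift by one in all later degrees.\<close>

lemma nonneg_comb_riesz_one: "nonneg_comb_riesz X F' 1 (\<lambda>x. 1)"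
proof -
  have "riesz_product X F' 1 (\<lambda>x. 1)"
    unfolding riesz_product_def by (intro conjI exI[of _ "\<lambda>_. 0"]) auto
  then show ?thesis
    by (intro nonneg_comb_rieszI[of 1 "\<lambda>_. 1" X F' 1 "\<lambda>_ _. 1"]) auto
qed

lemma nonneg_comb_riesz_add:
  assumes "nonneg_comb_riesz X F' d g" "nonneg_comb_riesz X F' d h"
  shows "nonneg_comb_riesz X F' d (\<lambda>x. g x + h x)"
proof -
  obtain n :: nat and c R where 1: "\<forall>j<n. c j \<ge> 0 \<and> riesz_product X F' d (R j)"
      "\<forall>x\<in>X. g x = (\<Sum>j<n. c j * R j x)"
    by (rule nonneg_comb_rieszE[OF assms(1)])
  obtain n' :: nat and c' R' where 2: "\<forall>j<n'. c' j \<ge> 0 \<and> riesz_product X F' d (R' j)"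
      "\<forall>x\<in>X. h x = (\<Sum>j<n'. c' j * R' j x)"
    by (rule nonneg_comb_rieszE[OF assms(2)])
  define C where "C = (\<lambda>j. if j < n then c j else c' (j - n))"
  define S where "S = (\<lambda>j. if j < n then R j else R' (j - n))"
  have "(\<Sum>j<n + n'. C j * S j x) = (\<Sum>j<n. c j * R j x) + (\<Sum>j<n'. c' j * R' j x)" for x
  proof (induction n')
    case 0
    show ?case by (simp add: C_def S_def)
  next
    case (Suc n')
    then show ?case by (simp add: C_def S_def)
  qed
  moreover have "C j \<ge> 0 \<and> riesz_product X F' d (S j)" if "j < n + n'" for j
    using that 1(1)[rule_format, of j] 2(1)[rule_format, of "j - n"] by (auto simp: C_def S_def)
  ultimately show ?thesis
    using 1(2) 2(2) by (intro nonneg_comb_rieszI[of "n + n'" C X F' d S]) auto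
qed

lemma nonneg_comb_riesz_cmult:
  assumes "nonneg_comb_riesz X F' d g" "0 \<le> a"
  shows "nonneg_comb_riesz X F' d (\<lambda>x. a * g x)"
proof -
  obtain n :: nat and c R where "\<forall>j<n. c j \<ge> 0 \<and> riesz_product X F' d (R j)"
      "\<forall>x\<in>X. g x = (\<Sum>j<n. c j * R j x)"
    by (rule nonneg_comb_rieszE[OF assms(1)])
  then show ?thesis
    using assms(2) by (intro nonneg_comb_rieszI[of n "\<lambda>j. a * c j" X F' d R])
      (auto simp: sum_distrib_left mult_ac)
qed

lemma nonneg_comb_riesz_sum:
  assumes "finite I" "\<And>i. i \<in> I \<Longrightarrow> nonneg_comb_riesz X F' d (g i)"
  shows "nonneg_comb_riesz X F' d (\<lambda>x. \<Sum>i\<in>I. g i x)"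
  using assms by (induction I rule: finite_induct)
    (auto intro: nonneg_comb_riesz_zero nonneg_comb_riesz_add)

lemma nonneg_comb_riesz_mult_factor:
  assumes "nonneg_comb_riesz X F' d g" and \<epsilon>: "\<epsilon> \<in> {-1, 0, 1}" "\<epsilon> \<noteq> 0 \<Longrightarrow> \<phi> \<in> F'"
  shows "nonneg_comb_riesz X F' (Suc d) (\<lambda>x. g x * (1 + \<epsilon> * \<phi> x))"
proof -
  obtain n :: nat and c R where *: "\<forall>j<n. c j \<ge> 0 \<and> riesz_product X F' d (R j)"
      "\<forall>x\<in>X. g x = (\<Sum>j<n. c j * R j x)"
    by (rule nonneg_comb_rieszE[OF assms(1)])
  have "riesz_product X F' (Suc d) (\<lambda>x. R j x * (1 + \<epsilon> * \<phi> x))" if "j < n" for j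
    by (rule riesz_product_mult_factor) (use that * \<epsilon> in auto)
  then show ?thesis
    using * by (intro nonneg_comb_rieszI[of n c X F' "Suc d" "\<lambda>j x. R j x * (1 + \<epsilon> * \<phi> x)"])
      (auto simp: sum_distrib_right mult.assoc)
qed

text \<open>Padding with factors of sign zero raises the degree, and does so even when
  \<open>F'\<close> is empty.\<close>

lemma nonneg_comb_riesz_mono:
  assumes "nonneg_comb_riesz X F' d g" "d \<le> d'"
  shows "nonneg_comb_riesz X F' d' g"
  using assms(2)
proof (induction rule: dec_induct)
  case base
  show ?case by (fact assms(1))
next
  case (step k)
  then show ?case using nonneg_comb_riesz_mult_factor[OF step.IH, of 0] by simp
qed

text \<open>Each summand of the base is a non-negative multiple of a single Riesz factor, so
  multiplying by the base and expanding stays in the cone. This is why the descent adds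
  \<open>s * (1 + \<epsilon> i * \<phi> i x)\<close> and not just the signed function.\<close>

lemma nonneg_comb_riesz_power:
  fixes n :: nat
  assumes \<epsilon>: "\<And>i. i < n \<Longrightarrow> \<epsilon> i \<in> {-1, 0, 1}" and \<phi>: "\<And>i. i < n \<Longrightarrow> \<phi> i \<in> F'" and "0 \<le> s"
  shows "nonneg_comb_riesz X F' (Suc k) (\<lambda>x. (\<Sum>i<n. s * (1 + \<epsilon> i * \<phi> i x)) ^ k)"
proof (induction k)
  case 0
  show ?case using nonneg_comb_riesz_one by simp
next
  case (Suc k)
  have "nonneg_comb_riesz X F' (Suc (Suc k))
      (\<lambda>x. \<Sum>i<n. s * ((\<Sum>i<n. s * (1 + \<epsilon> i * \<phi> i x)) ^ k * (1 + \<epsilon> i * \<phi> i x)))"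
    by (intro nonneg_comb_riesz_sum nonneg_comb_riesz_cmult nonneg_comb_riesz_mult_factor Suc
         finite_lessThan) (use assms in auto)
  then show ?case
    by (rule nonneg_comb_riesz_cong) (simp add: sum_distrib_left sum_distrib_right mult_ac)
qed

lemma nonneg_comb_riesz_taylor_corr:
  fixes n :: nat
  assumes \<epsilon>: "\<And>i. i < n \<Longrightarrow> \<epsilon> i \<in> {-1, 0, 1}" and \<phi>: "\<And>i. i < n \<Longrightarrow> \<phi> i \<in> F'"
    and "0 \<le> s" "0 \<le> m" "m < real d"
  shows "nonneg_comb_riesz X F' (Suc d) (\<lambda>x. taylor_corr d m (\<Sum>i<n. s * (1 + \<epsilon> i * \<phi> i x)))"
proof -
  let ?y = "\<lambda>x. \<Sum>i<n. s * (1 + \<epsilon> i * \<phi> i x)"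
  have p: "nonneg_comb_riesz X F' (Suc d) (\<lambda>x. ?y x ^ k)" if "k \<le> d" for k
    by (rule nonneg_comb_riesz_mono[OF nonneg_comb_riesz_power]) (use assms that in auto)
  have "nonneg_comb_riesz X F' (Suc d)
      (\<lambda>x. (\<Sum>k\<le>d. 1 / fact k * ?y x ^ k) + m / (real d - m) / fact d * ?y x ^ d)"
    by (intro nonneg_comb_riesz_add nonneg_comb_riesz_sum nonneg_comb_riesz_cmult p) (use assms in auto)
  then show ?thesis by (rule nonneg_comb_riesz_cong) (simp add: taylor_corr_def)
qed

section \<open>Expectations and Gibbs densities\<close>

lemma expect_add: "expect X \<mu> (\<lambda>x. g x + h x) = expect X \<mu> g + expect X \<mu> h"
  by (simp add: expect_def distrib_left sum.distrib)

lemma expect_diff: "expect X \<mu> (\<lambda>x. g x - h x) = expect X \<mu> g - expect X \<mu> h"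
  by (simp add: expect_def right_diff_distrib sum_subtractf)

lemma expect_cmult: "expect X \<mu> (\<lambda>x. a * h x) = a * expect X \<mu> h"
  by (simp add: expect_def sum_distrib_left mult_ac)

lemma expect_divide: "expect X \<mu> (\<lambda>x. h x / a) = expect X \<mu> h / a"
  by (simp add: expect_def sum_divide_distrib)

lemma expect_cong: "(\<And>x. x \<in> X \<Longrightarrow> g x = h x) \<Longrightarrow> expect X \<mu> g = expect X \<mu> h"
  by (simp add: expect_def)

lemma inner_mu_eq_expect: "inner_mu X \<mu> g h = expect X \<mu> (\<lambda>x. g x * h x)"
  by (simp add: inner_mu_def expect_def mult_ac)

definition gibbs :: "nat set \<Rightarrow> (nat \<Rightarrow> real) \<Rightarrow> (nat \<Rightarrow> real) \<Rightarrow> nat \<Rightarrow> real" where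
  "gibbs X \<mu> S x = exp (S x) / expect X \<mu> (\<lambda>x. exp (S x))"

locale finite_prob =
  fixes X :: "nat set" and \<mu> :: "nat \<Rightarrow> real"
  assumes prob: "prob_on X \<mu>"
begin

lemma expect_const: "expect X \<mu> (\<lambda>x. c) = c"
  using prob by (simp add: expect_def prob_on_def flip: sum_distrib_right)

lemma expect_mono: "(\<And>x. x \<in> X \<Longrightarrow> g x \<le> h x) \<Longrightarrow> expect X \<mu> g \<le> expect X \<mu> h"
  using prob by (auto simp: expect_def prob_on_def intro!: sum_mono mult_left_mono)

text \<open>Points may have weight zero, so positivity comes from a uniform lower bound of
  \<open>S\<close> on the finite set \<open>X\<close> and total mass 1.\<close>

lemma expect_exp_pos: "0 < expect X \<mu> (\<lambda>x. exp (S x))"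
proof -
  obtain c where c: "\<And>x. x \<in> X \<Longrightarrow> c \<le> S x"
    using prob bdd_below_finite[of "S ` X"] by (auto simp: prob_on_def bdd_below_def)
  have "0 < exp c" by simp
  also have "\<dots> \<le> expect X \<mu> (\<lambda>x. exp (S x))"
    using expect_mono[of "\<lambda>_. exp c" "\<lambda>x. exp (S x)"] c by (simp add: expect_const)
  finally show ?thesis .
qed

lemma gibbs_pos: "0 < gibbs X \<mu> S x"
  using expect_exp_pos by (simp add: gibbs_def)

lemma expect_gibbs: "expect X \<mu> (gibbs X \<mu> S) = 1"
  using expect_exp_pos[of S] unfolding gibbs_def by (simp add: expect_divide)

lemma gibbs_eq_exp: "gibbs X \<mu> S x = exp (S x - ln (expect X \<mu> (\<lambda>x. exp (S x))))"
  using expect_exp_pos[of S] by (simp add: gibbs_def exp_diff)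

lemma expect_density:
  assumes "density X \<mu> f"
  shows "expect X \<mu> f = 1"
proof -
  have "expect X \<mu> f = expect X \<mu> (\<lambda>x. \<bar>f x\<bar>)"
    by (rule expect_cong) (use assms in \<open>simp add: density_def\<close>)
  then show ?thesis using assms by (simp add: density_def)
qed

text \<open>Duality between the \<open>L1\<close> and sup norms; it turns the \<open>L1\<close>
  error of the truncation into a bound on the semi-norm.\<close>

lemma abs_expect_mult_le:
  assumes "\<And>x. x \<in> X \<Longrightarrow> \<bar>\<phi> x\<bar> \<le> 1"
  shows "\<bar>expect X \<mu> (\<lambda>x. \<phi> x * h x)\<bar> \<le> expect X \<mu> (\<lambda>x. \<bar>h x\<bar>)"
proof -
  have *: "\<bar>\<phi> x * h x\<bar> \<le> \<bar>h x\<bar>" if "x \<in> X" for x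
    using mult_right_mono[OF assms[OF that], of "\<bar>h x\<bar>"] by (simp add: abs_mult)
  have "expect X \<mu> (\<lambda>x. \<phi> x * h x) \<le> expect X \<mu> (\<lambda>x. \<bar>h x\<bar>)"
    by (rule expect_mono) (use * in fastforce)
  moreover have "expect X \<mu> (\<lambda>x. - 1 * \<bar>h x\<bar>) \<le> expect X \<mu> (\<lambda>x. \<phi> x * h x)"
    by (rule expect_mono) (use * in fastforce)
  ultimately show ?thesis unfolding expect_cmult by linarith
qed

section \<open>The Gibbs variational principle and mirror descent\<close>

text \<open>Relative entropy with respect to the Gibbs density is non-negative: apply
  \<open>ln t \<le> t - 1\<close> to the ratio of the Gibbs density to \<open>f\<close> where
  \<open>f\<close> is positive; at zeros of \<open>f\<close> the pointwise inequality only says that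
  the Gibbs density is non-negative. Integrating uses that both have mass 1.\<close>

lemma gibbs_variational:
  assumes f: "density X \<mu> f"
  shows "expect X \<mu> (\<lambda>x. f x * S x) - ln (expect X \<mu> (\<lambda>x. exp (S x))) \<le> Ent X \<mu> f"
proof -
  define l where "l = ln (expect X \<mu> (\<lambda>x. exp (S x)))"
  have "f x - gibbs X \<mu> S x \<le> (if f x = 0 then 0 else f x * ln (f x)) - (f x * S x - l * f x)"
    if "x \<in> X" for x
  proof (cases "f x = 0")
    case True
    then show ?thesis using gibbs_pos[of S x] by simp
  next
    case False
    then have f0: "f x > 0" using f that by (auto simp: density_def less_le)
    have "ln (gibbs X \<mu> S x / f x) \<le> gibbs X \<mu> S x / f x - 1"
      by (rule ln_le_minus_one) (use f0 gibbs_pos in auto)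
    moreover have "ln (gibbs X \<mu> S x / f x) = S x - l - ln (f x)"
      using f0 gibbs_pos[of S x] by (simp add: ln_div) (simp add: gibbs_eq_exp l_def)
    ultimately have "1 - gibbs X \<mu> S x / f x \<le> ln (f x) - S x + l" by simp
    then have "f x * (1 - gibbs X \<mu> S x / f x) \<le> f x * (ln (f x) - S x + l)"
      using f0 by (intro mult_left_mono) auto
    then show ?thesis using f0 by (simp add: algebra_simps)
  qed
  from expect_mono[OF this]
  have "expect X \<mu> f - expect X \<mu> (gibbs X \<mu> S)
     \<le> Ent X \<mu> f - (expect X \<mu> (\<lambda>x. f x * S x) - l * expect X \<mu> f)"
    by (simp add: expect_diff expect_cmult Ent_def)
  then show ?thesis by (simp add: expect_gibbs expect_density[OF f] l_def)
qed

lemma Ent_nonneg: "density X \<mu> f \<Longrightarrow> 0 \<le> Ent X \<mu> f"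
  using gibbs_variational[of f "\<lambda>_. 0"] by (simp add: expect_const)

text \<open>The shift contributes exactly \<open>exp s\<close>. The remaining factor
  \<open>exp (s * \<psi> x)\<close> is expanded to second order and averaged against the Gibbs
  density, and \<open>1 + t \<le> exp t\<close> brings the result back under the logarithm.\<close>

lemma ln_expect_exp_step:
  fixes \<psi> S :: "nat \<Rightarrow> real" and s :: real
  assumes \<psi>: "\<And>x. x \<in> X \<Longrightarrow> \<bar>\<psi> x\<bar> \<le> 1" and s: "0 \<le> s" "s \<le> 1"
  shows "ln (expect X \<mu> (\<lambda>x. exp (S x + s * (1 + \<psi> x))))
     \<le> ln (expect X \<mu> (\<lambda>x. exp (S x))) + s + s * expect X \<mu> (\<lambda>x. \<psi> x * gibbs X \<mu> S x) + s\<^sup>2"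
proof -
  let ?Z = "expect X \<mu> (\<lambda>x. exp (S x))"
  let ?t = "s * expect X \<mu> (\<lambda>x. \<psi> x * gibbs X \<mu> S x) + s\<^sup>2"
  have Z: "?Z > 0" by (rule expect_exp_pos)
  have pointwise: "exp (S x + s * (1 + \<psi> x))
      \<le> (?Z * exp s) * ((1 + s\<^sup>2) * gibbs X \<mu> S x + s * (\<psi> x * gibbs X \<mu> S x))" if "x \<in> X" for x
  proof -
    have "\<bar>s * \<psi> x\<bar> \<le> s" using mult_left_mono[OF \<psi>[OF that] s(1)] s by (simp add: abs_mult)
    then have "exp (s * \<psi> x) \<le> 1 + s * \<psi> x + (s * \<psi> x)\<^sup>2" "(s * \<psi> x)\<^sup>2 \<le> s\<^sup>2"
      using s by (auto intro!: exp_le_quadratic abs_le_square_iff[THEN iffD1])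
    then have "exp (s * \<psi> x) \<le> 1 + s\<^sup>2 + s * \<psi> x" by simp
    then have "exp (S x) * exp s * exp (s * \<psi> x) \<le> exp (S x) * exp s * (1 + s\<^sup>2 + s * \<psi> x)"
      by (rule mult_left_mono) simp
    moreover have "exp (S x + s * (1 + \<psi> x)) = exp (S x) * exp s * exp (s * \<psi> x)"
      by (simp add: distrib_left exp_add)
    moreover have "(?Z * exp s) * ((1 + s\<^sup>2) * gibbs X \<mu> S x + s * (\<psi> x * gibbs X \<mu> S x))
        = (?Z * gibbs X \<mu> S x) * exp s * (1 + s\<^sup>2 + s * \<psi> x)"
      by (simp add: algebra_simps)
    moreover have "?Z * gibbs X \<mu> S x = exp (S x)" using Z by (simp add: gibbs_def)
    ultimately show ?thesis by simp
  qed
  have "expect X \<mu> (\<lambda>x. exp (S x + s * (1 + \<psi> x)))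
      \<le> expect X \<mu> (\<lambda>x. (?Z * exp s) * ((1 + s\<^sup>2) * gibbs X \<mu> S x + s * (\<psi> x * gibbs X \<mu> S x)))"
    by (rule expect_mono) (rule pointwise)
  also have "\<dots> = (?Z * exp s) * (1 + ?t)"
    unfolding expect_cmult expect_add by (simp add: expect_gibbs)
  also have "\<dots> \<le> (?Z * exp s) * exp ?t"
    using Z exp_ge_add_one_self[of ?t] by (intro mult_left_mono) auto
  also have "\<dots> = exp (ln ?Z + s + ?t)" using Z by (simp add: exp_add)
  finally show ?thesis
    using expect_exp_pos[of "\<lambda>x. S x + s * (1 + \<psi> x)"] ln_le_of_le_exp by (simp add: add.assoc)
qed

text \<open>This is the relative entropy of \<open>f\<close> with respect to \<open>gibbs X \<mu> S\<close>.\<close>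

definition potential :: "(nat \<Rightarrow> real) \<Rightarrow> (nat \<Rightarrow> real) \<Rightarrow> real" where
  "potential f S = Ent X \<mu> f - expect X \<mu> (\<lambda>x. f x * S x) + ln (expect X \<mu> (\<lambda>x. exp (S x)))"

lemma potential_nonneg: "density X \<mu> f \<Longrightarrow> 0 \<le> potential f S"
  using gibbs_variational[of f S] by (simp add: potential_def)

text \<open>The gap yields a first-order gain of \<open>2 * s\<^sup>2\<close>, of which the
  second-order loss takes \<open>s\<^sup>2\<close>. The constant part \<open>s\<close> of the update
  cancels between the linear term and the logarithm.\<close>

lemma potential_step:
  fixes \<psi> S :: "nat \<Rightarrow> real" and s :: real
  assumes f: "density X \<mu> f" and \<psi>: "\<And>x. x \<in> X \<Longrightarrow> \<bar>\<psi> x\<bar> \<le> 1" and s: "0 \<le> s" "s \<le> 1"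
    and gap: "2 * s \<le> expect X \<mu> (\<lambda>x. \<psi> x * (f x - gibbs X \<mu> S x))"
  shows "potential f (\<lambda>x. S x + s * (1 + \<psi> x)) \<le> potential f S - s\<^sup>2"
proof -
  have "expect X \<mu> (\<lambda>x. f x * (S x + s * (1 + \<psi> x)))
      = expect X \<mu> (\<lambda>x. f x * S x + (s * f x + s * (\<psi> x * f x)))"
    by (rule expect_cong) (simp add: algebra_simps)
  also have "\<dots> = expect X \<mu> (\<lambda>x. f x * S x) + s + s * expect X \<mu> (\<lambda>x. \<psi> x * f x)"
    by (simp add: expect_add expect_cmult expect_density[OF f])
  finally have 1: "expect X \<mu> (\<lambda>x. f x * (S x + s * (1 + \<psi> x))) = \<dots>" .
  have "s * (2 * s) \<le> s * (expect X \<mu> (\<lambda>x. \<psi> x * f x) - expect X \<mu> (\<lambda>x. \<psi> x * gibbs X \<mu> S x))"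
    using gap s by (intro mult_left_mono) (simp_all add: right_diff_distrib expect_diff)
  moreover have "ln (expect X \<mu> (\<lambda>x. exp (S x + s * (1 + \<psi> x))))
     \<le> ln (expect X \<mu> (\<lambda>x. exp (S x))) + s + s * expect X \<mu> (\<lambda>x. \<psi> x * gibbs X \<mu> S x) + s\<^sup>2"
    by (rule ln_expect_exp_step) (use \<psi> s in auto)
  moreover have "s * (2 * s) = 2 * s\<^sup>2" by (simp add: power2_eq_square)
  ultimately show ?thesis
    unfolding potential_def 1 by (simp add: right_diff_distrib)
qed

text \<open>A longest run of steps each paying \<open>s\<^sup>2\<close> is chosen. It exists because
  the potential starts at \<open>Ent X \<mu> f\<close> and stays non-negative; since it cannot be
  prolonged, no function of \<open>F\<close>, with either sign, still separates \<open>f\<close>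
  from the Gibbs density by \<open>2 * s\<close>.\<close>

lemma entropy_descent:
  assumes F: "\<And>\<phi> x. \<phi> \<in> F \<Longrightarrow> x \<in> X \<Longrightarrow> \<bar>\<phi> x\<bar> \<le> 1" and f: "density X \<mu> f"
    and s: "0 < s" "s \<le> 1"
  obtains n \<phi> \<epsilon> where "\<And>i. i < n \<Longrightarrow> \<phi> i \<in> F" "\<And>i. i < n \<Longrightarrow> \<epsilon> i \<in> {-1, 1::real}"
    "real n * s\<^sup>2 \<le> Ent X \<mu> f"
    "Fnorm_le X \<mu> F (\<lambda>x. f x - gibbs X \<mu> (\<lambda>x. \<Sum>i<n. s * (1 + \<epsilon> i * \<phi> i x)) x) (2 * s)"
proof -
  define P where "P = (\<lambda>n (\<phi> :: nat \<Rightarrow> nat \<Rightarrow> real) (\<epsilon> :: nat \<Rightarrow> real).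
     (\<forall>i<n. \<phi> i \<in> F \<and> \<epsilon> i \<in> {-1, 1}) \<and>
     potential f (\<lambda>x. \<Sum>i<n. s * (1 + \<epsilon> i * \<phi> i x)) \<le> Ent X \<mu> f - real n * s\<^sup>2)"
  have bound: "real n * s\<^sup>2 \<le> Ent X \<mu> f" if "P n \<phi> \<epsilon>" for n \<phi> \<epsilon>
    using that potential_nonneg[OF f, of "\<lambda>x. \<Sum>i<n. s * (1 + \<epsilon> i * \<phi> i x)"] by (simp add: P_def)
  have fin: "n \<le> nat \<lfloor>Ent X \<mu> f / s\<^sup>2\<rfloor>" if "P n \<phi> \<epsilon>" for n \<phi> \<epsilon>
  proof -
    have "real n \<le> Ent X \<mu> f / s\<^sup>2" using bound[OF that] s by (simp add: field_simps)
    then show ?thesis by (simp add: le_nat_floor)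
  qed
  define Q where "Q = (\<lambda>n. \<exists>\<phi> \<epsilon>. P n \<phi> \<epsilon>)"
  define n where "n = (GREATEST n. Q n)"
  have "P 0 (\<lambda>_ _. 0) (\<lambda>_. 0)" by (simp add: P_def potential_def expect_const)
  then have Q0: "Q 0" unfolding Q_def by (intro exI)
  have Q_bound: "\<And>k. Q k \<Longrightarrow> k \<le> nat \<lfloor>Ent X \<mu> f / s\<^sup>2\<rfloor>"
    unfolding Q_def using fin by (elim exE)
  have max: "k \<le> n" if "Q k" for k
    unfolding n_def by (rule Greatest_le_nat[of Q, OF that]) (rule Q_bound)
  have "Q n" unfolding n_def by (rule GreatestI_nat[of Q, OF Q0]) (rule Q_bound)
  then obtain \<phi> \<epsilon> where P: "P n \<phi> \<epsilon>" unfolding Q_def by (elim exE)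
  define S where "S = (\<lambda>x. \<Sum>i<n. s * (1 + \<epsilon> i * \<phi> i x))"
  have no_step: "expect X \<mu> (\<lambda>x. (\<delta> * \<phi>' x) * (f x - gibbs X \<mu> S x)) < 2 * s"
    if "\<phi>' \<in> F" "\<delta> \<in> {-1, 1}" for \<phi>' \<delta>
  proof (rule ccontr)
    assume "\<not> ?thesis"
    then have "potential f (\<lambda>x. S x + s * (1 + \<delta> * \<phi>' x)) \<le> potential f S - s\<^sup>2"
      by (intro potential_step[OF f]) (use F s that in \<open>auto simp: abs_mult\<close>)
    moreover have "(\<Sum>i<Suc n. s * (1 + (\<epsilon>(n := \<delta>)) i * (\<phi>(n := \<phi>')) i x))
        = S x + s * (1 + \<delta> * \<phi>' x)" for x
      by (simp add: S_def)
    moreover have "(\<phi>(n := \<phi>')) i \<in> F \<and> (\<epsilon>(n := \<delta>)) i \<in> {-1, 1}" if "i < Suc n" for i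
      using P that \<open>\<phi>' \<in> F\<close> \<open>\<delta> \<in> _\<close> by (auto simp: P_def less_Suc_eq)
    ultimately have "P (Suc n) (\<phi>(n := \<phi>')) (\<epsilon>(n := \<delta>))"
      using P unfolding P_def S_def[symmetric]
      by (simp add: algebra_simps del: sum.lessThan_Suc fun_upd_apply)
    then have "Q (Suc n)" unfolding Q_def by (intro exI)
    then show False using max[of "Suc n"] by simp
  qed
  have "\<bar>expect X \<mu> (\<lambda>x. \<phi>' x * (f x - gibbs X \<mu> S x))\<bar> \<le> 2 * s" if "\<phi>' \<in> F" for \<phi>'
    using no_step[OF that, of 1] no_step[OF that, of "-1"]
      expect_cmult[of X \<mu> "- 1" "\<lambda>x. \<phi>' x * (f x - gibbs X \<mu> S x)"]
    by simp
  then have "Fnorm_le X \<mu> F (\<lambda>x. f x - gibbs X \<mu> S x) (2 * s)"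
    by (simp add: Fnorm_le_def inner_mu_eq_expect)
  with P bound[OF P] that[of n \<phi> \<epsilon>] show thesis by (auto simp: P_def S_def)
qed

text \<open>The left side is the entropy of the Gibbs density, whose logarithm is \<open>S\<close>
  minus the normaliser. Replacing that density by \<open>f\<close> in the average of
  \<open>S\<close> costs at most \<open>s * \<eta>\<close> per summand, the constants cancelling by
  equal mass; the variational principle for \<open>f\<close> then applies.\<close>

lemma Ent_gibbs_le:
  assumes f: "density X \<mu> f" and "0 \<le> s"
    and \<epsilon>: "\<And>i. i < n \<Longrightarrow> \<epsilon> i \<in> {-1, 1}" and \<phi>: "\<And>i. i < n \<Longrightarrow> \<phi> i \<in> F"
  defines "S \<equiv> \<lambda>x. \<Sum>i<n. s * (1 + \<epsilon> i * \<phi> i x)"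
  assumes close: "Fnorm_le X \<mu> F (\<lambda>x. f x - gibbs X \<mu> S x) \<eta>"
  shows "expect X \<mu> (\<lambda>x. gibbs X \<mu> S x * (S x - ln (expect X \<mu> (\<lambda>x. exp (S x)))))
     \<le> Ent X \<mu> f + real n * (s * \<eta>)"
proof -
  let ?g = "gibbs X \<mu> S" and ?l = "ln (expect X \<mu> (\<lambda>x. exp (S x)))"
  have term_le: "- (s * \<eta>) \<le> expect X \<mu> (\<lambda>x. s * (1 + \<epsilon> i * \<phi> i x) * (f x - ?g x))" if "i < n" for i
  proof -
    have "expect X \<mu> (\<lambda>x. s * (1 + \<epsilon> i * \<phi> i x) * (f x - ?g x))
       = expect X \<mu> (\<lambda>x. s * ((f x - ?g x) + \<epsilon> i * (\<phi> i x * (f x - ?g x))))"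
      by (rule expect_cong) (simp add: algebra_simps)
    also have "\<dots> = s * (\<epsilon> i * expect X \<mu> (\<lambda>x. \<phi> i x * (f x - ?g x)))"
      unfolding expect_cmult expect_add
      by (simp add: expect_diff expect_density[OF f] expect_gibbs)
    also have "\<dots> \<ge> s * (- \<eta>)"
    proof (rule mult_left_mono)
      have "\<bar>expect X \<mu> (\<lambda>x. \<phi> i x * (f x - ?g x))\<bar> \<le> \<eta>"
        using close \<phi>[OF that] by (simp add: Fnorm_le_def inner_mu_eq_expect)
      then show "- \<eta> \<le> \<epsilon> i * expect X \<mu> (\<lambda>x. \<phi> i x * (f x - ?g x))"
        using \<epsilon>[OF that] by auto
    qed fact
    finally show ?thesis by simp
  qed
  have "expect X \<mu> (\<lambda>x. S x * (f x - ?g x))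
     = (\<Sum>i<n. expect X \<mu> (\<lambda>x. s * (1 + \<epsilon> i * \<phi> i x) * (f x - ?g x)))"
    unfolding S_def expect_def sum_distrib_right sum_distrib_left by (rule sum.swap)
  also have "\<dots> \<ge> (\<Sum>i<n. - (s * \<eta>))"
    by (rule sum_mono) (use term_le in simp)
  finally have "- (real n * (s * \<eta>)) \<le> expect X \<mu> (\<lambda>x. f x * S x) - expect X \<mu> (\<lambda>x. ?g x * S x)"
    by (simp add: right_diff_distrib expect_diff mult.commute[of "S _"])
  moreover have "expect X \<mu> (\<lambda>x. ?g x * (S x - ?l)) = expect X \<mu> (\<lambda>x. ?g x * S x) - ?l"
    by (simp add: right_diff_distrib expect_diff mult.commute[of _ ?l] expect_cmult expect_gibbs)
  ultimately show ?thesis using gibbs_variational[OF f, of S] by simp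
qed

section \<open>Replacing the exponential by the corrected Taylor polynomial\<close>

text \<open>Up to the constant \<open>exp (- m)\<close>, the polynomial equals the Gibbs density
  times \<open>q m - \<delta> x\<close>, where the deficit \<open>\<delta>\<close> is quadratic in
  \<open>S x - m\<close>. Its mean \<open>D\<close> is at most \<open>\<beta>\<close> by the entropy
  comparison.\<close>

lemma truncated_gibbs:
  fixes S :: "nat \<Rightarrow> real"
  defines "m \<equiv> ln (expect X \<mu> (\<lambda>x. exp (S x)))"
  assumes S: "\<And>x. x \<in> X \<Longrightarrow> 0 \<le> S x" "\<And>x. x \<in> X \<Longrightarrow> S x \<le> M" and M: "2 * M \<le> real (Suc e)"
  defines "\<beta> \<equiv> exp M / (2 ^ e * real (Suc e)) * ((2 + M) * expect X \<mu> (\<lambda>x. gibbs X \<mu> S x * (S x - m)))"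
  assumes \<beta>: "\<beta> \<le> 1 / 2"
  obtains c where "0 \<le> c" "density X \<mu> (\<lambda>x. c * taylor_corr (Suc e) m (S x))"
    "expect X \<mu> (\<lambda>x. \<bar>gibbs X \<mu> S x - c * taylor_corr (Suc e) m (S x)\<bar>) \<le> 4 * \<beta>"
    "0 \<le> m" "m \<le> M"
proof -
  let ?g = "gibbs X \<mu> S" and ?K = "exp M / (2 ^ e * real (Suc e))"
  define q where "q = (\<lambda>y. exp (- y) * taylor_corr (Suc e) m y)"
  have "X \<noteq> {}" using prob by (auto simp: prob_on_def)
  then have M0: "0 \<le> M" using S by (meson equals0I order_trans)
  have Z: "expect X \<mu> (\<lambda>x. exp (S x)) > 0" by (rule expect_exp_pos)
  have "1 \<le> expect X \<mu> (\<lambda>x. exp (S x))"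
    using expect_mono[of "\<lambda>_. 1" "\<lambda>x. exp (S x)"] S by (simp add: expect_const)
  then have m0: "0 \<le> m" by (simp add: m_def)
  have "expect X \<mu> (\<lambda>x. exp (S x)) \<le> exp M"
    using expect_mono[of "\<lambda>x. exp (S x)" "\<lambda>_. exp M"] S by (simp add: expect_const)
  then have mM: "m \<le> M" using Z by (simp add: m_def ln_le_of_le_exp)
  have g: "?g x = exp (S x - m)" for x by (simp add: gibbs_eq_exp m_def)
  define \<delta> where "\<delta> = (\<lambda>x. q m - q (S x))"
  have \<delta>: "0 \<le> \<delta> x" "\<delta> x \<le> ?K * (S x - m)\<^sup>2" and qm: "1 \<le> q m" if "x \<in> X" for x
    using exp_taylor_corr_deficit[OF S(1)[OF that] S(2)[OF that] m0 mM M]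
    by (auto simp: \<delta>_def q_def)
  have qm: "1 \<le> q m" using qm \<open>X \<noteq> {}\<close> by blast
  define D where "D = expect X \<mu> (\<lambda>x. ?g x * \<delta> x)"
  have pointwise: "?g x * \<delta> x \<le> ?K * ((2 + M) * (?g x * (S x - m) - ?g x + 1))" if "x \<in> X" for x
  proof -
    have "?g x * \<delta> x \<le> ?g x * (?K * (S x - m)\<^sup>2)"
      by (rule mult_left_mono[OF \<delta>(2)[OF that]]) (simp add: g)
    also have "\<dots> = ?K * ((S x - m)\<^sup>2 * exp (S x - m))" by (simp add: g)
    also have "\<dots> \<le> ?K * ((2 + M) * ((S x - m) * exp (S x - m) - exp (S x - m) + 1))"
      by (intro mult_left_mono square_exp_le_entropy_integrand) (use S(2)[OF that] m0 M0 in auto)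
    finally show ?thesis by (simp add: g mult.commute)
  qed
  have "D \<le> expect X \<mu> (\<lambda>x. ?K * ((2 + M) * (?g x * (S x - m) - ?g x + 1)))"
    unfolding D_def by (rule expect_mono) (rule pointwise)
  also have "\<dots> = \<beta>"
    unfolding \<beta>_def expect_cmult expect_add expect_diff by (simp add: expect_gibbs expect_const)
  finally have D\<beta>: "D \<le> \<beta>" .
  have D0: "0 \<le> D"
    using expect_mono[of "\<lambda>_. 0" "\<lambda>x. ?g x * \<delta> x"] \<delta>(1) gibbs_pos[of S]
    by (simp add: D_def expect_const less_imp_le)
  \<comment> \<open>The mass of the polynomial multiplied by \<open>exp (- m)\<close>; it is bounded
    below since \<open>q m \<ge> 1\<close> and \<open>D \<le> 1 / 2\<close>.\<close>
  define r where "r = q m - D"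
  have r: "1 / 2 \<le> r" using qm D\<beta> \<beta> by (simp add: r_def)
  define c where "c = exp (- m) / r"
  have c0: "0 \<le> c" using r by (simp add: c_def)
  have ct: "c * taylor_corr (Suc e) m (S x) = (q m * ?g x - ?g x * \<delta> x) / r" for x
    by (simp add: \<delta>_def q_def g c_def algebra_simps flip: exp_add)
  have ct1: "expect X \<mu> (\<lambda>x. c * taylor_corr (Suc e) m (S x)) = 1"
    unfolding ct expect_divide expect_diff expect_cmult expect_gibbs D_def[symmetric]
    using r by (simp add: r_def)
  have ct0: "0 \<le> c * taylor_corr (Suc e) m (S x)" if "x \<in> X" for x
    using taylor_corr_ge_one[OF S(1)[OF that] m0, of "Suc e"] mM M M0 c0 by simp
  have dens: "density X \<mu> (\<lambda>x. c * taylor_corr (Suc e) m (S x))"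
    unfolding density_def using ct0 ct1 expect_cong[of X "\<lambda>x. \<bar>c * taylor_corr (Suc e) m (S x)\<bar>"]
    by simp
  have pointwise: "\<bar>?g x - c * taylor_corr (Suc e) m (S x)\<bar> \<le> 2 * (?g x * \<delta> x + D * ?g x)" if "x \<in> X" for x
  proof -
    \<comment> \<open>Normalising by \<open>r\<close> cancels the multiple \<open>q m\<close>,
      however large, so only the deviation of \<open>\<delta>\<close> from its mean is left.\<close>
    have "?g x - c * taylor_corr (Suc e) m (S x) = ?g x * (\<delta> x - D) / r"
      using r unfolding ct by (simp add: field_simps) (simp add: r_def algebra_simps)
    then have "\<bar>?g x - c * taylor_corr (Suc e) m (S x)\<bar> = ?g x * \<bar>\<delta> x - D\<bar> / r"
      using r gibbs_pos[of S x] by (simp add: abs_mult)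
    also have "\<dots> \<le> ?g x * (\<delta> x + D) / (1 / 2)"
      using r gibbs_pos[of S x] \<delta>(1)[OF that] D0
      by (intro frac_le mult_left_mono) (auto simp: less_imp_le)
    finally show ?thesis by (simp add: algebra_simps)
  qed
  have "expect X \<mu> (\<lambda>x. \<bar>?g x - c * taylor_corr (Suc e) m (S x)\<bar>)
      \<le> expect X \<mu> (\<lambda>x. 2 * (?g x * \<delta> x + D * ?g x))"
    by (rule expect_mono) (rule pointwise)
  also have "\<dots> = 4 * D"
    unfolding expect_cmult expect_add D_def[symmetric] expect_gibbs by simp
  finally show thesis using that[OF c0 dens _ m0 mM] D\<beta> by simp
qed

end

section \<open>Choice of the degree and the approximation theorem\<close>

text \<open>Since \<open>ln 2 \<ge> 3 / 5\<close>, the power \<open>2 powr (2 * M)\<close> exceeds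
  \<open>exp M\<close> by a factor \<open>exp (M / 5)\<close>, which absorbs \<open>2 + M\<close> up
  to the constant 5. The factor \<open>M\<close> is absorbed by \<open>real (Suc e)\<close>, and the
  six extra degrees pay for the constants.\<close>

lemma truncation_error_small:
  fixes M :: real
  assumes "0 \<le> M" "2 * M + 6 \<le> real (Suc e)"
  shows "exp M / (2 ^ e * real (Suc e)) * ((2 + M) * M) \<le> 1 / 6"
proof -
  have "exp (3 / 5 :: real) = exp (3 / 10) * exp (3 / 10)" by (simp flip: exp_add)
  also have "\<dots> \<le> 139 / 100 * (139 / 100)"
    using exp_le_quadratic[of "3 / 10"] by (intro mult_mono) (auto simp: power2_eq_square)
  finally have "exp (3 / 5 :: real) \<le> 2" by simp
  then have "3 / 5 \<le> ln (2 :: real)" by (subst ln_ge_iff) auto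
  then have "exp (6 * M / 5) \<le> exp (2 * M * ln 2)"
    using mult_left_mono[of "3 / 5" "ln 2" "2 * M"] assms by simp
  then have "exp (6 * M / 5) * 64 \<le> 2 powr (2 * M) * 2 powr 6"
    by (simp add: powr_def[of 2 "2 * M"])
  also have "\<dots> = 2 powr (2 * M + 6)" by (simp add: powr_add)
  also have "\<dots> \<le> 2 powr real (Suc e)"
    using assms by (intro powr_mono) auto
  also have "\<dots> = 2 * 2 ^ e" by (subst powr_realpow) auto
  finally have e: "exp (6 * M / 5) * 32 \<le> 2 ^ e" by simp
  have "2 + M \<le> 5 * exp (M / 5)" using exp_ge_add_one_self[of "M / 5"] assms(1) by linarith
  then have "exp M * (2 + M) \<le> exp M * (5 * exp (M / 5))" by (rule mult_left_mono) simp
  also have "\<dots> = 5 * exp (6 * M / 5)" by (simp flip: exp_add)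
  also have "\<dots> \<le> 2 ^ e / 6" using e exp_gt_zero[of "6 * M / 5"] by linarith
  finally have 1: "exp M * (2 + M) \<le> 2 ^ e / 6" .
  have "exp M * (2 + M) * M \<le> 2 ^ e / 6 * real (Suc e)"
    by (rule mult_mono[OF 1]) (use assms in auto)
  then have "exp M * (2 + M) * M / (2 ^ e * real (Suc e)) \<le> 1 / 6"
    by (subst pos_divide_le_eq) auto
  then show ?thesis by (simp add: mult.assoc)
qed

theorem theorem2p1:
  shows "\<exists>C::real. \<forall>(X::nat set) (\<mu>::nat \<Rightarrow> real) (F::(nat \<Rightarrow> real) set) (\<eta>::real) (f::nat \<Rightarrow> real).
    prob_on X \<mu> \<longrightarrow> (\<forall>\<phi>\<in>F. \<forall>x\<in>X. \<bar>\<phi> x\<bar> \<le> 1) \<longrightarrow>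
    0 < \<eta> \<longrightarrow> \<eta> < exp (-3) \<longrightarrow> density X \<mu> f \<longrightarrow>
    (\<exists>g. density X \<mu> g \<and>
       Fnorm_le X \<mu> F (\<lambda>x. f x - g x) \<eta> \<and>
       (\<exists>F' d. F' \<subseteq> F \<and> finite F' \<and>
          real (card F') \<le> 9 * Ent X \<mu> f / \<eta>\<^sup>2 \<and>
          real d \<le> 12 * Ent X \<mu> f / \<eta> + C * (ln (1/\<eta>) / ln (ln (1/\<eta>))) \<and>
          nonneg_comb_riesz X F' d g))"
\<comment> \<open>The degree will be at most \<open>2 * M + 8\<close>, and the ratio multiplying the
  constant is at least 1.\<close>
proof (intro exI[of _ 8] allI impI)
  fix X \<mu> and F :: "(nat \<Rightarrow> real) set" and \<eta> :: real and f
  assume prob: "prob_on X \<mu>" and F: "\<forall>\<phi>\<in>F. \<forall>x\<in>X. \<bar>\<phi> x\<bar> \<le> 1"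
    and \<eta>: "0 < \<eta>" "\<eta> < exp (-3)" and f: "density X \<mu> f"
  interpret finite_prob X \<mu> by standard (fact prob)
  \<comment> \<open>The descent leaves an error of \<open>2 * s\<close>, so one third of
    \<open>\<eta>\<close> remains for the truncation; \<open>1 / s\<^sup>2\<close> is the 9 in the
    bound on \<open>F'\<close>.\<close>
  define s where "s = \<eta> / 3"
  have "\<eta> < 1" using \<eta> less_trans[of \<eta> "exp (-3)" 1] by simp
  then have s: "0 < s" "s \<le> 1" using \<eta> by (auto simp: s_def)
  obtain n \<phi> \<epsilon> where \<phi>: "\<And>i. i < n \<Longrightarrow> \<phi> i \<in> F" and \<epsilon>: "\<And>i. i < n \<Longrightarrow> \<epsilon> i \<in> {-1, 1::real}"
    and n: "real n * s\<^sup>2 \<le> Ent X \<mu> f"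
    and close: "Fnorm_le X \<mu> F (\<lambda>x. f x - gibbs X \<mu> (\<lambda>x. \<Sum>i<n. s * (1 + \<epsilon> i * \<phi> i x)) x) (2 * s)"
    using entropy_descent[of F f s] F f s by blast
  define S where "S = (\<lambda>x. \<Sum>i<n. s * (1 + \<epsilon> i * \<phi> i x))"
  define m where "m = ln (expect X \<mu> (\<lambda>x. exp (S x)))"
  \<comment> \<open>Equal to \<open>2 * Ent X \<mu> f / s\<close>: at most
    \<open>Ent X \<mu> f / s\<^sup>2\<close> steps, each adding at most
    \<open>2 * s\<close>.\<close>
  define M where "M = 6 * Ent X \<mu> f / \<eta>"
  define e where "e = nat \<lceil>2 * M\<rceil> + 5"
  define F' where "F' = \<phi> ` {..<n}"
  have M0: "0 \<le> M" using Ent_nonneg[OF f] \<eta> by (simp add: M_def)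
  have e: "2 * M + 6 \<le> real (Suc e)" "real (Suc (Suc e)) \<le> 2 * M + 8"
    using M0 by (auto simp: e_def) linarith+
  have factor: "0 \<le> s * (1 + \<epsilon> i * \<phi> i x)" "s * (1 + \<epsilon> i * \<phi> i x) \<le> 2 * s" if "i < n" "x \<in> X" for i x
  proof -
    have "\<bar>\<phi> i x\<bar> \<le> 1" using F \<phi> that by blast
    then show "0 \<le> s * (1 + \<epsilon> i * \<phi> i x)" "s * (1 + \<epsilon> i * \<phi> i x) \<le> 2 * s"
      using \<epsilon>[OF that(1)] s by (auto simp: mult.commute)
  qed
  have S0: "0 \<le> S x" if "x \<in> X" for x
    unfolding S_def by (rule sum_nonneg) (use factor that in auto)
  have SM: "S x \<le> M" if "x \<in> X" for x
  proof -
    have "S x \<le> (\<Sum>i<n. 2 * s)" unfolding S_def by (rule sum_mono) (use factor that in auto)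
    also have "\<dots> = 2 * (real n * s\<^sup>2) / s" using s by (simp add: power2_eq_square)
    also have "\<dots> \<le> 2 * Ent X \<mu> f / s" using n s by (intro divide_right_mono) auto
    also have "\<dots> = M" by (simp add: M_def s_def)
    finally show ?thesis .
  qed
  define H where "H = expect X \<mu> (\<lambda>x. gibbs X \<mu> S x * (S x - m))"
  define K where "K = exp M / (2 ^ e * real (Suc e))"
  have "H \<le> Ent X \<mu> f + real n * (s * (2 * s))"
    unfolding H_def m_def S_def
    by (rule Ent_gibbs_le[OF f _ \<epsilon> \<phi> close]) (use s in auto)
  also have "\<dots> \<le> 3 * Ent X \<mu> f" using n by (simp add: power2_eq_square algebra_simps)
  \<comment> \<open>The entropy of the Gibbs density is small compared with \<open>M\<close>; this
    factor \<open>\<eta>\<close> lets a bounded number of extra degrees suffice.\<close>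
  also have "\<dots> = \<eta> / 2 * M" using \<eta> by (simp add: M_def)
  finally have "K * ((2 + M) * H) \<le> K * ((2 + M) * (\<eta> / 2 * M))"
    using M0 by (intro mult_left_mono) (auto simp: K_def)
  also have "\<dots> = \<eta> / 2 * (K * ((2 + M) * M))" by simp
  also have "\<dots> \<le> \<eta> / 2 * (1 / 6)"
    unfolding K_def by (intro mult_left_mono truncation_error_small M0 e) (use \<eta> in auto)
  finally have err: "K * ((2 + M) * H) \<le> \<eta> / 12" by simp
  have d: "2 * M \<le> real (Suc e)" using e by linarith
  have err_half: "K * ((2 + M) * H) \<le> 1 / 2" using err \<open>\<eta> < 1\<close> by linarith
  obtain c where c: "0 \<le> c" "density X \<mu> (\<lambda>x. c * taylor_corr (Suc e) m (S x))"
    "expect X \<mu> (\<lambda>x. \<bar>gibbs X \<mu> S x - c * taylor_corr (Suc e) m (S x)\<bar>) \<le> 4 * (K * ((2 + M) * H))"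
    "0 \<le> m" "m \<le> M"
    using truncated_gibbs[OF S0 SM d err_half[unfolded K_def H_def m_def]]
    unfolding K_def H_def m_def by blast
  define g where "g = (\<lambda>x. c * taylor_corr (Suc e) m (S x))"
  have "\<bar>inner_mu X \<mu> \<psi> (\<lambda>x. f x - g x)\<bar> \<le> \<eta>" if "\<psi> \<in> F" for \<psi>
  proof -
    have "inner_mu X \<mu> \<psi> (\<lambda>x. f x - g x) = expect X \<mu> (\<lambda>x. \<psi> x * (f x - gibbs X \<mu> S x))
        + expect X \<mu> (\<lambda>x. \<psi> x * (gibbs X \<mu> S x - g x))"
      unfolding inner_mu_eq_expect expect_add[symmetric] by (simp add: algebra_simps)
    moreover have "\<bar>expect X \<mu> (\<lambda>x. \<psi> x * (f x - gibbs X \<mu> S x))\<bar> \<le> 2 * s"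
      using close that unfolding Fnorm_le_def inner_mu_eq_expect S_def by blast
    moreover have "\<bar>expect X \<mu> (\<lambda>x. \<psi> x * (gibbs X \<mu> S x - g x))\<bar> \<le> \<eta> / 3"
      using abs_expect_mult_le[of \<psi> "\<lambda>x. gibbs X \<mu> S x - g x"] F that c(3) err by (force simp: g_def)
    ultimately show ?thesis by (simp add: s_def)
  qed
  then have "Fnorm_le X \<mu> F (\<lambda>x. f x - g x) \<eta>" by (simp add: Fnorm_le_def)
  moreover have "density X \<mu> g" using c by (simp add: g_def)
  moreover have "nonneg_comb_riesz X F' (Suc (Suc e)) g"
    unfolding g_def S_def
    by (intro nonneg_comb_riesz_cmult nonneg_comb_riesz_taylor_corr)
       (use c s e \<epsilon> M0 in \<open>auto simp: F'_def\<close>)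
  moreover have "real (card F') \<le> 9 * Ent X \<mu> f / \<eta>\<^sup>2"
  proof -
    have "real (card F') \<le> real n" using card_image_le[of "{..<n}" \<phi>] by (simp add: F'_def)
    also have "\<dots> \<le> Ent X \<mu> f / s\<^sup>2" using n s by (simp add: field_simps)
    finally show ?thesis by (simp add: s_def power_divide mult.commute)
  qed
  moreover have "real (Suc (Suc e)) \<le> 12 * Ent X \<mu> f / \<eta> + 8 * (ln (1/\<eta>) / ln (ln (1/\<eta>)))"
  proof -
    \<comment> \<open>The iterated logarithm is then positive and at most
      \<open>ln (1/\<eta>)\<close>, so the ratio is at least 1.\<close>
    have "ln \<eta> < - 3" using \<eta> ln_less_cancel_iff[of \<eta> "exp (- 3)"] by simp
    then have L: "ln (1/\<eta>) > 3" using \<eta> by (simp add: ln_div)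
    then have "ln (ln (1/\<eta>)) > 0" "ln (ln (1/\<eta>)) \<le> ln (1/\<eta>)"
      using ln_le_minus_one[of "ln (1/\<eta>)"] by (auto intro: ln_gt_zero)
    then have "1 \<le> ln (1/\<eta>) / ln (ln (1/\<eta>))" by simp
    then show ?thesis using e(2) by (simp add: M_def)
  qed
  moreover have "F' \<subseteq> F" "finite F'" using \<phi> by (auto simp: F'_def)
  ultimately show "\<exists>g. density X \<mu> g \<and> Fnorm_le X \<mu> F (\<lambda>x. f x - g x) \<eta> \<and>
       (\<exists>F' d. F' \<subseteq> F \<and> finite F' \<and> real (card F') \<le> 9 * Ent X \<mu> f / \<eta>\<^sup>2 \<and>
          real d \<le> 12 * Ent X \<mu> f / \<eta> + 8 * (ln (1/\<eta>) / ln (ln (1/\<eta>))) \<and>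
          nonneg_comb_riesz X F' d g)"
    by blast
qed

end
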